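(* For all integers $n\ge 0$, the Lucas-Fubini number $\mathcal{L}_n$ satisfies the Dobiński-like formula $$\mathcal{L}_n=\frac{\alpha}{e^{\alpha}}\sum_{k\geq 0} \frac{\alpha^k k^n}{k!}+\frac{\beta}{e^{\beta}}\sum_{k\geq 0} \frac{\beta^k k^n}{k!}.$$
   Context: $\alpha=(1+\sqrt5)/2$ and $\beta=(1-\sqrt5)/2$. Convention: $0^0=1$. ${n\brace k}$ denotes the Stirling number of the second kind (the number of partitions of an $n$-element set into exactly $k$ non-empty blocks). $L_m$ denotes the Lucas numbers: $L_0=2$, $L_1=1$, $L_m=L_{m-1}+L_{m-2}$ for $m\ge2$. The Lucas-Fubini numbers are defined by $\mathcal{L}_n=\sum_{k=0}^n L_{k+1}{n\brace k}$ for $n\ge0$. *)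

theory Defs
  imports Complex_Main "HOL-Combinatorics.Stirling" "HOL-Library.Disjoint_Sets"
begin

definition set_partitions :: "'a set \<Rightarrow> nat \<Rightarrow> 'a set set set" where
  "set_partitions A k = {P. partition_on A P \<and> card P = k}"

lemma set_partitions_insert:
  assumes "finite A" "a \<notin> A"
  shows "set_partitions (insert a A) (Suc k) =
    insert {a} ` set_partitions A k \<union>
    (\<lambda>(Q, B). insert (insert a B) (Q - {B})) ` (SIGMA Q:set_partitions A (Suc k). Q)"
    (is "?L = ?R1 \<union> ?R2")
proof (intro equalityI subsetI)
  fix P assume "P \<in> ?L"
  then have P: "partition_on (insert a A) P" and cP: "card P = Suc k"
    by (auto simp: set_partitions_def)
  have finP: "finite P" using cP card.infinite by fastforce
  obtain C where C: "C \<in> P" "a \<in> C"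
    using partition_onD1[OF P] by blast
  have PC: "P = insert C (P - {C})" using C by blast
  have dj: "disjnt C (\<Union>(P - {C}))"
    using partition_onD2[OF P] C by (auto simp: disjoint_def disjnt_def)
  have rest: "partition_on (insert a A - C) (P - {C})" and sub: "C \<subseteq> insert a A"
    using P partition_on_insert[OF dj, of "insert a A"] PC by auto
  have cr: "card (P - {C}) = k" using cP C finP by simp
  show "P \<in> ?R1 \<union> ?R2"
  proof (cases "C = {a}")
    case True
    then have "insert a A - C = A" using assms by auto
    then have "P - {C} \<in> set_partitions A k"
      using rest cr by (simp add: set_partitions_def)
    then show ?thesis using PC True by blast
  next
    case False
    define B where "B = C - {a}"
    have CB: "C = insert a B" and aB: "a \<notin> B" and Bne: "B \<noteq> {}" and BA: "B \<subseteq> A"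
      using False C sub by (auto simp: B_def)
    have djB: "disjnt B (\<Union>(P - {C}))" using dj CB by (auto simp: disjnt_def)
    then have BP: "B \<notin> P - {C}" using Bne by (auto simp: disjnt_def)
    have eq: "insert a A - C = A - B" using assms(2) CB by auto
    have "partition_on A (insert B (P - {C}))"
      using partition_on_insert[OF djB, of A] rest eq BA Bne by auto
    moreover have "card (insert B (P - {C})) = Suc k"
      using BP finP cr by simp
    ultimately have "(insert B (P - {C}), B) \<in> (SIGMA Q:set_partitions A (Suc k). Q)"
      by (simp add: set_partitions_def)
    moreover have "P = insert (insert a B) (insert B (P - {C}) - {B})"
      using BP PC CB by auto
    then have "P = (\<lambda>(Q, B). insert (insert a B) (Q - {B})) (insert B (P - {C}), B)" by simp
    ultimately have "P \<in> ?R2" by (rule rev_image_eqI)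
    then show ?thesis by blast
  qed
next
  fix P assume "P \<in> ?R1 \<union> ?R2"
  then show "P \<in> ?L"
  proof
    assume "P \<in> ?R1"
    then obtain Q where Q: "partition_on A Q" "card Q = k" "P = insert {a} Q"
      by (auto simp: set_partitions_def)
    have dj: "disjnt {a} (\<Union>Q)" using partition_onD1[OF Q(1)] assms by (auto simp: disjnt_def)
    have "{a} \<notin> Q" using dj by (auto simp: disjnt_def)
    moreover have "finite Q" using assms(1) Q(1) by (rule finite_elements)
    moreover have "insert a A - {a} = A" using assms by auto
    ultimately show ?thesis
      using partition_on_insert[OF dj, of "insert a A"] Q by (simp add: set_partitions_def)
  next
    assume "P \<in> ?R2"
    then obtain Q B where Q: "partition_on A Q" "card Q = Suc k" "B \<in> Q"
      "P = insert (insert a B) (Q - {B})"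
      by (auto simp: set_partitions_def)
    have finQ: "finite Q" using assms(1) Q(1) by (rule finite_elements)
    have UQ: "A = \<Union>Q" using partition_onD1[OF Q(1)] .
    have djB: "disjnt B (\<Union>(Q - {B}))"
      using partition_onD2[OF Q(1)] Q(3) by (auto simp: disjoint_def disjnt_def)
    have dj: "disjnt (insert a B) (\<Union>(Q - {B}))"
      using djB UQ assms(2) by (auto simp: disjnt_def)
    have "partition_on (A - B) (Q - {B})"
      using partition_on_insert[OF djB, of A] Q(1,3) by (simp add: insert_absorb)
    moreover have "insert a A - insert a B = A - B" using assms(2) by auto
    moreover have "insert a B \<subseteq> insert a A" using Q(3) UQ by auto
    ultimately have "partition_on (insert a A) P"
      using partition_on_insert[OF dj, of "insert a A"] Q(4) by auto
    moreover have "insert a B \<notin> Q" using UQ assms(2) by auto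
    then have "card P = Suc k" using Q finQ by simp
    ultimately show ?thesis by (simp add: set_partitions_def)
  qed
qed

text \<open>
  The library introduces \<open>Stirling\<close> by its recurrence; the following fact is its
  combinatorial meaning.
\<close>

lemma card_set_partitions:
  assumes "finite A"
  shows "card (set_partitions A k) = Stirling (card A) k"
  using assms
proof (induction A arbitrary: k rule: finite_induct)
  case empty
  have "set_partitions ({} :: 'a set) k = {P. P = {} \<and> k = 0}"
    unfolding set_partitions_def partition_on_empty by (metis card.empty)
  then show ?case by (cases k) simp_all
next
  case (insert a A)
  have fin: "finite (set_partitions A j)" for j
  proof (rule finite_subset)
    show "set_partitions A j \<subseteq> Pow (Pow A)"
      by (auto simp: set_partitions_def partition_on_def)
    show "finite (Pow (Pow A))" using insert by simp
  qed
  show ?case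
  proof (cases k)
    case 0
    have "card P \<noteq> 0" if "partition_on (insert a A) P" for P
      using that insert(1) finite_elements[of "insert a A" P] by (auto simp: partition_on_def)
    then have "set_partitions (insert a A) 0 = {}"
      by (auto simp: set_partitions_def)
    then show ?thesis using 0 insert by simp
  next
    case (Suc m)
    let ?R1 = "insert {a} ` set_partitions A m"
    let ?S = "SIGMA Q:set_partitions A (Suc m). Q"
    let ?f = "\<lambda>(Q, B). insert (insert a B) (Q - {B})"
    have notin: "a \<notin> B" if "Q \<in> set_partitions A j" "B \<in> Q" for Q B j
      using that insert(2) by (auto simp: set_partitions_def partition_on_def)
    have inj1: "inj_on (insert {a}) (set_partitions A m)"
    proof (rule inj_onI)
      fix P Q assume h: "P \<in> set_partitions A m" "Q \<in> set_partitions A m"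
        "insert {a} P = insert {a} Q"
      have "{a} \<notin> P" "{a} \<notin> Q" using notin h by blast+
      then show "P = Q" using h(3) by (simp add: insert_ident)
    qed
    have inj2: "inj_on ?f ?S"
    proof (rule inj_onI, clarify)
      fix Q B Q' B'
      assume h: "Q \<in> set_partitions A (Suc m)" "B \<in> Q"
        "Q' \<in> set_partitions A (Suc m)" "B' \<in> Q'"
        and eq: "insert (insert a B) (Q - {B}) = insert (insert a B') (Q' - {B'})"
      have n: "a \<notin> B" "a \<notin> B'" "insert a B \<notin> Q" "insert a B \<notin> Q'" "insert a B' \<notin> Q"
        using notin h by blast+
      have "insert a B = insert a B'" using eq n by auto
      then have BB: "B = B'" using n by (simp add: insert_ident)
      then have "Q - {B} = Q' - {B}" using eq n by (simp add: insert_ident)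
      then show "Q = Q' \<and> B = B'" using BB h by blast
    qed
    have new: "{a} \<notin> P" if PS: "P \<in> ?f ` ?S" for P
    proof
      assume aP: "{a} \<in> P"
      from PS obtain Q B where h: "Q \<in> set_partitions A (Suc m)" "B \<in> Q"
        "P = insert (insert a B) (Q - {B})" by auto
      have "B \<noteq> {}" using h by (auto simp: set_partitions_def partition_on_def)
      moreover have "a \<notin> B" "{a} \<notin> Q" using notin h by blast+
      ultimately show False using aP h(3) by auto
    qed
    have disj: "?R1 \<inter> ?f ` ?S = {}"
    proof (rule equals0I, erule IntE)
      fix P assume "P \<in> ?R1" and PS: "P \<in> ?f ` ?S"
      then have "{a} \<in> P" by (elim imageE) simp
      then show False using new[OF PS] by contradiction
    qed
    have finQ: "finite Q" if "Q \<in> set_partitions A (Suc m)" for Q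
      by (rule card_ge_0_finite) (use that in \<open>simp add: set_partitions_def\<close>)
    have finS: "finite ?S" by (rule finite_SigmaI[OF fin finQ])
    have "card ?S = (\<Sum>Q\<in>set_partitions A (Suc m). card Q)"
      using fin finQ by (simp add: card_SigmaI)
    also have "\<dots> = (\<Sum>Q\<in>set_partitions A (Suc m). Suc m)"
      by (rule sum.cong) (auto simp: set_partitions_def)
    also have "\<dots> = Suc m * Stirling (card A) (Suc m)"
      using insert.IH by simp
    finally have cS: "card ?S = Suc m * Stirling (card A) (Suc m)" .
    have "card (set_partitions (insert a A) (Suc m)) = card ?R1 + card (?f ` ?S)"
      unfolding set_partitions_insert[OF insert(1,2)]
      by (rule card_Un_disjoint) (use fin finS disj in auto)
    also have "\<dots> = Stirling (card A) m + Suc m * Stirling (card A) (Suc m)"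
      using card_image[OF inj1] card_image[OF inj2] insert.IH cS by simp
    finally show ?thesis using Suc insert(1,2) by simp
  qed
qed

fun lucas :: "nat \<Rightarrow> nat" where
  "lucas 0 = 2"
| "lucas (Suc 0) = 1"
| "lucas (Suc (Suc m)) = lucas (Suc m) + lucas m"

definition lucas_fubini :: "nat \<Rightarrow> nat" where
  "lucas_fubini n = (\<Sum>k=0..n. lucas (k + 1) * Stirling n k)"

definition alpha :: real where
  "alpha = (1 + sqrt 5) / 2"

definition beta :: real where
  "beta = (1 - sqrt 5) / 2"

end

theory Submission
  imports Defs
begin

text \<open>
  Expanding \<open>k ^ n\<close> into falling factorials, with Stirling numbers as coefficients, reduces the
  series \<open>\<Sum>k. x ^ k * k ^ n / fact k\<close> to shifted exponential series and gives Dobinski's formula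
  with the Touchard polynomial: the sum is \<open>exp x * (\<Sum>j\<le>n. Stirling n j * x ^ j)\<close>. Taking
  \<open>x = alpha\<close> and \<open>x = beta\<close>, Binet's formula for the Lucas numbers combines the two values.
\<close>

text \<open>\<open>fact j * (k choose j)\<close> is the falling factorial k(k-1)...(k-j+1). Writing
  k = (k - j) + j, multiplication by k turns it into the next one plus j times itself, which mirrors
  the Stirling recurrence.\<close>

lemma power_eq_sum_Stirling_binomial:
  "(k::nat) ^ n = (\<Sum>j\<le>n. Stirling n j * (fact j * (k choose j)))"
proof (induction n)
  case 0
  show ?case by simp
next
  case (Suc n)
  let ?F = "\<lambda>j. fact j * (k choose j)"
  have step: "k * ?F j = ?F (Suc j) + j * ?F j" for j
  proof (cases "j \<le> k")
    case True
    have "Suc j * (k choose Suc j) = (k - j) * (k choose j)"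
      by (metis binomial_absorb_comp binomial_absorption mult.commute)
    then have "?F (Suc j) = fact j * ((k - j) * (k choose j))"
      by (metis fact_Suc mult.commute mult.left_commute of_nat_id)
    also have "\<dots> + j * ?F j = ((k - j) + j) * ?F j" by (simp only: algebra_simps)
    finally show ?thesis using True by simp
  qed (simp add: binomial_eq_0)
  have "k ^ Suc n = (\<Sum>j\<le>n. Stirling n j * (k * ?F j))"
    by (simp add: Suc sum_distrib_left mult.left_commute)
  also have "\<dots> = (\<Sum>j\<le>n. Stirling n j * ?F (Suc j)) + (\<Sum>j\<le>n. j * Stirling n j * ?F j)"
    unfolding step by (simp only: sum.distrib distrib_left mult.assoc mult.left_commute)
  \<comment> \<open>The added top term vanishes because \<open>Stirling n (Suc n)\<close> is 0; in
    the shift that follows, the factor j kills the term at 0.\<close>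
  also have "(\<Sum>j\<le>n. j * Stirling n j * ?F j) = (\<Sum>j\<le>Suc n. j * Stirling n j * ?F j)"
    by simp
  also have "\<dots> = (\<Sum>j\<le>n. Suc j * Stirling n (Suc j) * ?F (Suc j))"
    by (subst sum.atMost_Suc_shift) simp
  also have "(\<Sum>j\<le>n. Stirling n j * ?F (Suc j)) + \<dots>
      = (\<Sum>j\<le>n. Stirling (Suc n) (Suc j) * ?F (Suc j))"
    by (simp only: sum.distrib [symmetric] Stirling.simps distrib_right add.commute)
  also have "\<dots> = (\<Sum>j\<le>Suc n. Stirling (Suc n) j * ?F j)"
    by (subst sum.atMost_Suc_shift) simp
  finally show ?case .
qed

text \<open>The binomial vanishes for k < j, and from k = j on it cancels against
  \<open>fact k\<close>, leaving x^j times the exponential series.\<close>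

lemma sums_falling_factorial_exp:
  fixes x :: real
  shows "(\<lambda>k. x ^ k * real (fact j * (k choose j)) / fact k) sums (x ^ j * exp x)"
    (is "?f sums _")
proof -
  have "?f (i + j) = x ^ j * (x ^ i /\<^sub>R fact i)" for i
  proof -
    have "fact j * fact i * real (i + j choose j) = fact (i + j)"
      using binomial_fact_lemma [of j "i + j"] by (metis add_diff_cancel_right' le_add2 of_nat_fact of_nat_mult)
    then have "real (fact j * (i + j choose j)) / fact (i + j) = 1 / fact i"
      by (simp add: field_simps)
    then have "?f (i + j) = x ^ (i + j) * (1 / fact i)"
      by (metis times_divide_eq_right)
    then show ?thesis by (simp add: power_add divide_inverse)
  qed
  then have "(\<lambda>i. ?f (i + j)) sums (x ^ j * exp x)"
    using sums_mult [OF exp_converges [of x], of "x ^ j"] by presburger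
  moreover have "(\<Sum>i<j. ?f i) = 0" by (simp add: binomial_eq_0)
  ultimately show ?thesis using sums_iff_shift [of ?f j "x ^ j * exp x"] by (simp only: add_0_right)
qed

theorem Dobinski_Touchard:
  fixes x :: real
  shows "(\<lambda>k. x ^ k * real k ^ n / fact k) sums (exp x * (\<Sum>j\<le>n. real (Stirling n j) * x ^ j))"
proof -
  \<comment> \<open>Only finitely many series are added, so the sums over j and k may be exchanged
    freely.\<close>
  have "(\<lambda>k. \<Sum>j\<le>n. real (Stirling n j) * (x ^ k * real (fact j * (k choose j)) / fact k))
      sums (\<Sum>j\<le>n. real (Stirling n j) * (x ^ j * exp x))"
    by (intro sums_sum sums_mult sums_falling_factorial_exp)
  moreover have "(\<Sum>j\<le>n. real (Stirling n j) * (x ^ k * real (fact j * (k choose j)) / fact k))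
      = x ^ k * real k ^ n / fact k" for k
  proof -
    have "real k ^ n = (\<Sum>j\<le>n. real (Stirling n j) * real (fact j * (k choose j)))"
      by (metis (mono_tags, lifting) of_nat_mult of_nat_power of_nat_sum
          power_eq_sum_Stirling_binomial sum.cong)
    then show ?thesis
      by (simp add: sum_distrib_left sum_divide_distrib mult.left_commute)
  qed
  ultimately show ?thesis by (simp add: sum_distrib_left mult_ac)
qed

text \<open>Both numbers are roots of x^2 = x + 1, so their powers obey the Lucas recurrence; the
  initial values agree.\<close>

lemma lucas_Binet: "real (lucas m) = alpha ^ m + beta ^ m"
proof (induction m rule: lucas.induct)
  case (3 m)
  have "alpha\<^sup>2 = alpha + 1" "beta\<^sup>2 = beta + 1"
    by (simp_all add: alpha_def beta_def power2_eq_square field_simps)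
  then have "alpha ^ Suc (Suc m) = alpha ^ Suc m + alpha ^ m"
    "beta ^ Suc (Suc m) = beta ^ Suc m + beta ^ m"
    by (simp_all add: power2_eq_square flip: mult.assoc) (simp_all add: algebra_simps)
  then show ?case using 3 by simp
qed (simp_all add: alpha_def beta_def field_simps)

theorem theorem6:
  fixes n :: nat
  shows "summable (\<lambda>k. alpha ^ k * real k ^ n / fact k) \<and>
         summable (\<lambda>k. beta ^ k * real k ^ n / fact k) \<and>
         real (lucas_fubini n) =
           alpha / exp alpha * (\<Sum>k. alpha ^ k * real k ^ n / fact k) +
           beta / exp beta * (\<Sum>k. beta ^ k * real k ^ n / fact k)"
proof -
  \<comment> \<open>The denominator cancels the factor \<open>exp x\<close>, and the numerator
    raises each exponent to the shifted index \<open>k + 1\<close> of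
    \<open>lucas_fubini\<close>.\<close>
  have term_eq: "x / exp x * (\<Sum>k. x ^ k * real k ^ n / fact k)
      = (\<Sum>j\<le>n. real (Stirling n j) * x ^ (j + 1))" for x :: real
    by (simp add: sums_unique [OF Dobinski_Touchard, symmetric] sum_distrib_left mult.left_commute)
  have "real (lucas_fubini n) = (\<Sum>j\<le>n. real (Stirling n j) * (alpha ^ (j + 1) + beta ^ (j + 1)))"
    unfolding lucas_fubini_def by (simp add: lucas_Binet atLeast0AtMost mult.commute del: lucas.simps)
  then show ?thesis
    unfolding term_eq using sums_summable [OF Dobinski_Touchard]
    by (simp add: distrib_left sum.distrib)
qed

end
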